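(* Fix $q>0$ and $\lambda>0$. Then $$\lim_{n\to\infty}\frac{1}{n}\log Z_{n,\lambda,q}[K]=\log \pi_1(\lambda),$$ where $K$ is the event that $K_n(\omega)$ is connected. Moreover, convergence is uniform for $\lambda$ belonging to compact subsets of $[0,\infty)$.
   Context: Let $K_n=(V_n,E_n)$ be the complete graph on $n$ vertices. For $\omega\in\{0,1\}^{E_n}$ let $K_n(\omega)$ be the graph on $V_n$ with edge set $\{e\in E_n:\omega_e=1\}$, and let $k(\omega)$ be its number of connected components (isolated vertices count as components). For $q>0$ and $\lambda\ge 0$, put $p=\lambda/n$ (a number in $[0,1]$), and for an event $A\subset\{0,1\}^{E_n}$ define the unnormalised random cluster weight $$Z_{n,\lambda,q}[A]=\sum_{\omega\in A}\Big\{\prod_{e\in E_n}p^{\omega_e}(1-p)^{1-\omega_e}\Big\}q^{k(\omega)}.$$ Let $\pi_1(x)=1-e^{-x}$ for $x\in[0,\infty)$. *)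

theory Defs
  imports "HOL-Analysis.Analysis"
begin

definition vertices :: "nat \<Rightarrow> nat set" where
  "vertices n = {1..n}"

definition edges :: "nat \<Rightarrow> nat set set" where
  "edges n = {e. e \<subseteq> vertices n \<and> card e = 2}"

(* Extensional functions, so that a configuration carries no data outside the edge set. *)
definition configs :: "nat \<Rightarrow> (nat set \<Rightarrow> nat) set" where
  "configs n = edges n \<rightarrow>\<^sub>E {0, 1}"

definition open_edges :: "nat \<Rightarrow> (nat set \<Rightarrow> nat) \<Rightarrow> nat set set" where
  "open_edges n \<omega> = {e \<in> edges n. \<omega> e = 1}"

definition joined :: "'a set \<Rightarrow> 'a set set \<Rightarrow> 'a rel" where
  "joined V F = {(u, v) \<in> V \<times> V. (u, v) \<in> {(x, y). {x, y} \<in> F}\<^sup>*}"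

lemma equiv_joined: "equiv V (joined V F)"
proof (rule equivI)
  show "refl_on V (joined V F)" by (auto simp: joined_def refl_on_def)
  have "sym ({(x, y). {x, y} \<in> F}\<^sup>*)"
    by (rule sym_rtrancl) (auto simp: sym_def insert_commute)
  then show "sym (joined V F)" by (auto simp: joined_def sym_def)
  show "trans (joined V F)" by (auto simp: joined_def trans_def)
qed (auto simp: joined_def)

definition components :: "'a set \<Rightarrow> 'a set set \<Rightarrow> 'a set set" where
  "components V F = V // joined V F"

definition connected_graph :: "'a set \<Rightarrow> 'a set set \<Rightarrow> bool" where
  "connected_graph V F \<longleftrightarrow> V \<noteq> {} \<and> (\<forall>u\<in>V. \<forall>v\<in>V. (u, v) \<in> joined V F)"

definition num_components :: "nat \<Rightarrow> (nat set \<Rightarrow> nat) \<Rightarrow> nat" where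
  "num_components n \<omega> = card (components (vertices n) (open_edges n \<omega>))"

(* Defined for all real arguments, but p = l / n is a probability only for 0 \<le> l \<le> n;
   this holds for all large n, uniformly for l in a compact set. *)
definition rc_weight :: "nat \<Rightarrow> real \<Rightarrow> real \<Rightarrow> (nat set \<Rightarrow> nat) set \<Rightarrow> real" where
  "rc_weight n l q A =
     (let p = l / real n in
      \<Sum>\<omega>\<in>A. (\<Prod>e\<in>edges n. p ^ \<omega> e * (1 - p) ^ (1 - \<omega> e)) * q ^ num_components n \<omega>)"

definition connected_event :: "nat \<Rightarrow> (nat set \<Rightarrow> nat) set" where
  "connected_event n = {\<omega> \<in> configs n. connected_graph (vertices n) (open_edges n \<omega>)}"

definition pi1 :: "real \<Rightarrow> real" where
  "pi1 x = 1 - exp (- x)"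

(* The logarithm with log 0 = -\<infinity>, whereas the real function has ln 0 = 0.
   Values at negative arguments are irrelevant. *)
definition elog :: "real \<Rightarrow> ereal" where
  "elog x = (if x > 0 then ereal (ln x) else -\<infinity>)"

(* Uniform convergence of extended-real-valued functions.  The extended reals form a compact
   Hausdorff space, and so carry exactly one uniformity compatible with their topology: the
   neighbourhoods of the diagonal.  (Equivalently: uniform convergence for any metric inducing
   the topology.)  The distance \<bar>x - y\<bar> is of no use where the limit function is infinite. *)
definition ereal_uniform_limit ::
    "'a set \<Rightarrow> ('b \<Rightarrow> 'a \<Rightarrow> ereal) \<Rightarrow> ('a \<Rightarrow> ereal) \<Rightarrow> 'b filter \<Rightarrow> bool" where
  "ereal_uniform_limit S f g F \<longleftrightarrow>
     (\<forall>U. open U \<and> (\<forall>y. (y, y) \<in> U) \<longrightarrow> (\<forall>\<^sub>F n in F. \<forall>x\<in>S. (f n x, g x) \<in> U))"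

end

theory Submission
  imports Defs
begin

text \<open>
  A connected graph has one component, so the weight of the connected graphs is \<open>q\<close> times the
  probability \<open>P\<close> that the random graph on \<open>n\<close> vertices with edge probability \<open>p = l / n\<close> is
  connected.  The proof rests on the two-sided estimate, valid for every \<open>n \<ge> 1\<close> and
  \<open>p \<in> [0, 1]\<close>,
  \[ \frac1n \, w^{n-1} \le P \le w^{n-1}, \qquad w = 1 - (1 - p)^n . \]
  The factor \<open>1 / n\<close> and the constant \<open>q\<close> disappear in the normalised logarithm, and \<open>w\<close> tends
  to \<open>pi1 l\<close>.

  The estimate is the case \<open>A = {1}\<close> of lemma \<open>reach_prob_bounds\<close>, about the probability that
  every vertex of a random graph on \<open>W\<close> is joined to a set \<open>A \<subseteq> W\<close> of active vertices.  This
  generality gives a recursion (\<open>reach_prob_recursion\<close>): reveal the edges at one active vertex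
  \<open>v\<close>, delete \<open>v\<close>, and make its new neighbours active.  Both bounds are preserved by the
  recursion, and only Bernoulli's inequality \<open>1 - (1 - p)^n \<le> n p\<close> is used.

  The bounds have a probabilistic meaning.  Suppose that one vertex is explored per time step and
  that each vertex outside \<open>A\<close> is discovered at an independent geometric time.  For all of \<open>W\<close> to
  be reached, all these times must be at most \<open>card W\<close>, which has probability \<open>w^card (W - A)\<close>.
  Given this, the active set must not run out too early.  If the times were uniform on
  \<open>{1..card W}\<close>, this would have probability \<open>card A / card W\<close>, by the cycle lemma; geometric
  times are stochastically earlier, which only helps.

  All estimates are explicit in \<open>n\<close>, and are uniform for \<open>l\<close> in an interval \<open>[m, M]\<close> with
  \<open>m > 0\<close>.  Near \<open>l = 0\<close>, where the limit is \<open>-\<infinity>\<close>, the upper bound alone is enough: it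
  pushes the normalised logarithm below any prescribed level.
\<close>

section \<open>Averages over a random subset\<close>

text \<open>
  The expectation of \<open>f S\<close> when each element of \<open>X\<close> is put into \<open>S\<close> independently with
  probability \<open>p\<close>.
\<close>
definition subset_mean :: "real \<Rightarrow> 'a set \<Rightarrow> ('a set \<Rightarrow> real) \<Rightarrow> real" where
  "subset_mean p X f = (\<Sum>S\<in>Pow X. p ^ card S * (1 - p) ^ card (X - S) * f S)"

lemma subset_mean_empty [simp]: "subset_mean p {} f = f {}"
  by (simp add: subset_mean_def)

lemma subset_mean_insert:
  assumes "finite X" "x \<notin> X"
  shows "subset_mean p (insert x X) f =
           (1 - p) * subset_mean p X f + p * subset_mean p X (\<lambda>S. f (insert x S))"
proof -
  let ?g = "\<lambda>S. p ^ card S * (1 - p) ^ card (insert x X - S) * f S"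
  have inj: "inj_on (insert x) (Pow X)"
    using assms(2) by (auto simp: inj_on_def)
  have "subset_mean p (insert x X) f = sum ?g (Pow X) + sum ?g (insert x ` Pow X)"
    unfolding subset_mean_def Pow_insert using assms by (intro sum.union_disjoint) auto
  also have "sum ?g (Pow X) = (1 - p) * subset_mean p X f"
    unfolding subset_mean_def sum_distrib_left
  proof (rule sum.cong[OF refl])
    fix S assume "S \<in> Pow X"
    then have "insert x X - S = insert x (X - S)" using assms(2) by auto
    then show "?g S = (1 - p) * (p ^ card S * (1 - p) ^ card (X - S) * f S)"
      using assms by simp
  qed
  also have "sum ?g (insert x ` Pow X) = p * subset_mean p X (\<lambda>S. f (insert x S))"
    unfolding subset_mean_def sum_distrib_left sum.reindex[OF inj] comp_def
  proof (rule sum.cong[OF refl])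
    fix S assume S: "S \<in> Pow X"
    then have "insert x X - insert x S = X - S" using assms(2) by auto
    moreover have "card (insert x S) = Suc (card S)"
      using S assms by (metis PowD card_insert_disjoint finite_subset subsetD)
    ultimately show "?g (insert x S) = p * (p ^ card S * (1 - p) ^ card (X - S) * f (insert x S))"
      by simp
  qed
  finally show ?thesis .
qed

text \<open>
  Independence: a random subset of a disjoint union is a pair of independent random subsets.  This
  is what allows the edges at one vertex to be revealed before all others.
\<close>
lemma subset_mean_Un:
  assumes "finite X" "finite Y" "X \<inter> Y = {}"
  shows "subset_mean p (X \<union> Y) f = subset_mean p X (\<lambda>S. subset_mean p Y (\<lambda>T. f (S \<union> T)))"
  using assms(1,3)
proof (induction X arbitrary: f rule: finite_induct)
  case (insert x X)
  then show ?case using assms(2) by (simp add: subset_mean_insert)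
qed simp

lemma subset_mean_image:
  assumes "finite X" "inj_on h X"
  shows "subset_mean p (h ` X) f = subset_mean p X (\<lambda>S. f (h ` S))"
  using assms
proof (induction X arbitrary: f rule: finite_induct)
  case (insert x X)
  then have "h x \<notin> h ` X" by auto
  then show ?case using insert by (simp add: subset_mean_insert)
qed simp

lemma subset_mean_const: "finite X \<Longrightarrow> subset_mean p X (\<lambda>_. c) = c"
  by (induction X rule: finite_induct) (simp_all add: subset_mean_insert algebra_simps)

lemma subset_mean_cmult: "subset_mean p X (\<lambda>S. c * f S) = c * subset_mean p X f"
  by (simp add: subset_mean_def sum_distrib_left mult_ac)

lemma subset_mean_add: "subset_mean p X (\<lambda>S. f S + g S) = subset_mean p X f + subset_mean p X g"
  by (simp add: subset_mean_def sum.distrib distrib_left)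

lemma subset_mean_cong:
  assumes "\<And>S. S \<subseteq> X \<Longrightarrow> f S = g S"
  shows "subset_mean p X f = subset_mean p X g"
  unfolding subset_mean_def using assms by (intro sum.cong) auto

lemma subset_mean_mono:
  assumes "0 \<le> p" "p \<le> 1" "\<And>S. S \<subseteq> X \<Longrightarrow> f S \<le> g S"
  shows "subset_mean p X f \<le> subset_mean p X g"
  unfolding subset_mean_def using assms by (intro sum_mono mult_left_mono) auto

text \<open>
  The generating function of the number of elements that are left out.  This and the next identity
  are the two averages that occur when the bounds on the reachability probability are fed into the
  recursion; the next one is a derivative of the joint generating function of \<open>card S\<close> and
  \<open>card (X - S)\<close>.
\<close>
lemma subset_mean_power:
  assumes "finite X"
  shows "subset_mean p X (\<lambda>S. z ^ card (X - S)) = (p + (1 - p) * z) ^ card X"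
  using assms
proof (induction X rule: finite_induct)
  case (insert x X)
  have 1: "subset_mean p X (\<lambda>S. z ^ card (insert x X - S)) = z * subset_mean p X (\<lambda>S. z ^ card (X - S))"
    unfolding subset_mean_cmult[symmetric]
  proof (rule subset_mean_cong)
    fix S assume "S \<subseteq> X"
    then have "insert x X - S = insert x (X - S)" using insert.hyps by auto
    then show "z ^ card (insert x X - S) = z * z ^ card (X - S)" using insert.hyps by simp
  qed
  have 2: "insert x X - insert x S = X - S" for S using insert.hyps by auto
  show ?case using insert by (simp add: subset_mean_insert 1 2 algebra_simps)
qed simp

lemma subset_mean_card_power:
  assumes "finite X"
  shows "subset_mean p X (\<lambda>S. real (card S) * z ^ card (X - S))
           = real (card X) * p * (p + (1 - p) * z) ^ (card X - 1)"
  using assms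
proof (induction X rule: finite_induct)
  case (insert x X)
  let ?m = "p + (1 - p) * z"
  have 1: "subset_mean p X (\<lambda>S. real (card S) * z ^ card (insert x X - S))
             = z * subset_mean p X (\<lambda>S. real (card S) * z ^ card (X - S))"
    unfolding subset_mean_cmult[symmetric]
  proof (rule subset_mean_cong)
    fix S assume "S \<subseteq> X"
    then have "insert x X - S = insert x (X - S)" using insert.hyps by auto
    then show "real (card S) * z ^ card (insert x X - S) = z * (real (card S) * z ^ card (X - S))"
      using insert.hyps by simp
  qed
  have 2: "subset_mean p X (\<lambda>S. real (card (insert x S)) * z ^ card (X - S))
             = ?m ^ card X + subset_mean p X (\<lambda>S. real (card S) * z ^ card (X - S))"
    unfolding subset_mean_power[OF insert.hyps(1), symmetric] subset_mean_add[symmetric]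
  proof (rule subset_mean_cong)
    fix S assume S: "S \<subseteq> X"
    then have "card (insert x S) = Suc (card S)"
      using insert.hyps by (metis card_insert_disjoint finite_subset subsetD)
    then show "real (card (insert x S)) * z ^ card (X - S)
        = z ^ card (X - S) + real (card S) * z ^ card (X - S)"
      by (simp add: algebra_simps)
  qed
  have 3: "?m * (real (card X) * p * ?m ^ (card X - 1)) = real (card X) * p * ?m ^ card X"
    by (cases "card X") simp_all
  have "subset_mean p (insert x X) (\<lambda>S. real (card S) * z ^ card (insert x X - S))
      = p * ?m ^ card X + ?m * (real (card X) * p * ?m ^ (card X - 1))"
    using insert by (simp add: subset_mean_insert 1 2 algebra_simps)
  then show ?case unfolding 3 using insert.hyps by (simp add: algebra_simps)
qed simp

section \<open>Exploring a random graph\<close>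

definition adj :: "'a set set \<Rightarrow> 'a rel" where
  "adj F = {(x, y). {x, y} \<in> F}"

text \<open>The edges of the complete graph on \<open>W\<close>, for vertex sets that shrink during the exploration.\<close>
definition pairs :: "'a set \<Rightarrow> 'a set set" where
  "pairs W = {e. e \<subseteq> W \<and> card e = 2}"

definition reached_from :: "'a set \<Rightarrow> 'a set \<Rightarrow> 'a set set \<Rightarrow> bool" where
  "reached_from A W F \<longleftrightarrow> (\<forall>w\<in>W. \<exists>a\<in>A. (a, w) \<in> (adj F)\<^sup>*)"

definition reach_prob :: "real \<Rightarrow> 'a set \<Rightarrow> 'a set \<Rightarrow> real" where
  "reach_prob p A W = subset_mean p (pairs W) (\<lambda>F. of_bool (reached_from A W F))"

lemma finite_pairs: "finite W \<Longrightarrow> finite (pairs W)"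
  unfolding pairs_def by (rule finite_subset[of _ "Pow W"]) auto

lemma pairs_star:
  assumes "v \<in> W"
  shows "pairs W = (\<lambda>s. {v, s}) ` (W - {v}) \<union> pairs (W - {v})"
proof (rule set_eqI, rule iffI)
  fix e assume "e \<in> pairs W"
  then obtain x y where "e = {x, y}" "x \<noteq> y" "x \<in> W" "y \<in> W"
    by (auto simp: pairs_def card_2_iff)
  then show "e \<in> (\<lambda>s. {v, s}) ` (W - {v}) \<union> pairs (W - {v})"
    by (cases "x = v"; cases "y = v") (auto simp: pairs_def card_2_iff)
next
  fix e assume "e \<in> (\<lambda>s. {v, s}) ` (W - {v}) \<union> pairs (W - {v})"
  then show "e \<in> pairs W" using assms by (auto simp: pairs_def card_2_iff)
qed

text \<open>
  A path that starts in \<open>A\<close> and uses \<open>v\<close> can be cut after its last visit to \<open>v\<close>; what remains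
  avoids \<open>v\<close> and starts at a neighbour of \<open>v\<close>.  So the active vertex \<open>v\<close> may be deleted once its
  neighbours \<open>J\<close> have become active.
\<close>
lemma reached_from_star:
  assumes v: "v \<in> A" "v \<in> W" and J: "J \<subseteq> W - {v}" and F: "F \<subseteq> pairs (W - {v})"
  shows "reached_from A W ((\<lambda>s. {v, s}) ` J \<union> F) \<longleftrightarrow> reached_from ((A - {v}) \<union> J) (W - {v}) F"
    (is "?L \<longleftrightarrow> ?R")
proof
  let ?G = "(\<lambda>s. {v, s}) ` J \<union> F"
  have reach: "w = v \<or> (\<exists>b \<in> (A - {v}) \<union> J. (b, w) \<in> (adj F)\<^sup>*)"
    if "a \<in> A" "(a, w) \<in> (adj ?G)\<^sup>*" for a w
    using that(2)
  proof (induction rule: rtrancl_induct)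
    case base
    then show ?case using that(1) by auto
  next
    case (step y z)
    show ?case
    proof (cases "z = v")
      case False
      from step.hyps(2) consider "{y, z} \<in> F" | "\<exists>s\<in>J. {y, z} = {v, s}"
        by (auto simp: adj_def)
      then show ?thesis
      proof cases
        case 1
        then have "y \<noteq> v" using F by (auto simp: pairs_def)
        then obtain b where "b \<in> (A - {v}) \<union> J" "(b, y) \<in> (adj F)\<^sup>*" using step.IH by auto
        moreover have "(y, z) \<in> adj F" using 1 by (simp add: adj_def)
        ultimately show ?thesis by (meson rtrancl.rtrancl_into_rtrancl)
      next
        case 2
        then have "z \<in> J" using False by (auto simp: doubleton_eq_iff)
        then show ?thesis by auto
      qed
    qed simp
  qed
  assume L: ?L
  show ?R
    unfolding reached_from_def
  proof
    fix w assume w: "w \<in> W - {v}"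
    then obtain a where "a \<in> A" "(a, w) \<in> (adj ?G)\<^sup>*" using L by (auto simp: reached_from_def)
    then show "\<exists>b \<in> (A - {v}) \<union> J. (b, w) \<in> (adj F)\<^sup>*" using reach w by blast
  qed
next
  let ?G = "(\<lambda>s. {v, s}) ` J \<union> F"
  assume R: ?R
  have sub: "(adj F)\<^sup>* \<subseteq> (adj ?G)\<^sup>*" by (rule rtrancl_mono) (auto simp: adj_def)
  show ?L
    unfolding reached_from_def
  proof
    fix w assume w: "w \<in> W"
    show "\<exists>a\<in>A. (a, w) \<in> (adj ?G)\<^sup>*"
    proof (cases "w = v")
      case False
      then obtain b where b: "b \<in> (A - {v}) \<union> J" "(b, w) \<in> (adj ?G)\<^sup>*"
        using R w sub by (fastforce simp: reached_from_def)
      show ?thesis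
      proof (cases "b \<in> J")
        case True
        then have "(v, b) \<in> adj ?G" by (auto simp: adj_def)
        then show ?thesis using b v(1) by (meson converse_rtrancl_into_rtrancl)
      qed (use b in auto)
    qed (use v in auto)
  qed
qed

text \<open>
  The edges at \<open>v\<close> are independent of the graph on \<open>W - {v}\<close>.  The edges from \<open>v\<close> to other active
  vertices do not change the active set, so their average is trivial and only the new neighbours
  \<open>J \<subseteq> W - A\<close> remain.
\<close>
lemma reach_prob_recursion:
  assumes W: "finite W" and v: "v \<in> A" and A: "A \<subseteq> W"
  shows "reach_prob p A W =
           subset_mean p (W - A) (\<lambda>J. reach_prob p ((A - {v}) \<union> J) (W - {v}))"
proof -
  let ?star = "\<lambda>s. {v, s}"
  have vW: "v \<in> W" using v A by auto
  have split: "(W - A) \<union> (A - {v}) = W - {v}" using v A by auto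
  have inj: "inj_on ?star (W - {v})" by (auto simp: inj_on_def doubleton_eq_iff)
  have disj: "?star ` (W - {v}) \<inter> pairs (W - {v}) = {}" by (auto simp: pairs_def)
  have "reach_prob p A W = subset_mean p (W - {v}) (\<lambda>K. subset_mean p (pairs (W - {v}))
          (\<lambda>F. of_bool (reached_from A W (?star ` K \<union> F))))"
    unfolding reach_prob_def pairs_star[OF vW]
    using W by (simp add: subset_mean_Un[OF _ _ disj] subset_mean_image[OF _ inj] finite_pairs)
  also have "\<dots> = subset_mean p (W - {v}) (\<lambda>K. reach_prob p ((A - {v}) \<union> K) (W - {v}))"
    unfolding reach_prob_def
    by (intro subset_mean_cong) (simp add: reached_from_star[OF v vW])
  also have "\<dots> = subset_mean p ((W - A) \<union> (A - {v})) (\<lambda>K. reach_prob p ((A - {v}) \<union> K) (W - {v}))"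
    unfolding split[symmetric] by (rule refl)
  also have "\<dots> = subset_mean p (W - A) (\<lambda>J. subset_mean p (A - {v})
        (\<lambda>I. reach_prob p ((A - {v}) \<union> (J \<union> I)) (W - {v})))"
    using W A by (intro subset_mean_Un) (auto intro: finite_subset)
  also have "\<dots> = subset_mean p (W - A) (\<lambda>J. subset_mean p (A - {v})
        (\<lambda>I. reach_prob p ((A - {v}) \<union> J) (W - {v})))"
  proof (intro subset_mean_cong)
    fix J I assume "I \<subseteq> A - {v}"
    then have "(A - {v}) \<union> (J \<union> I) = (A - {v}) \<union> J" by auto
    then show "reach_prob p ((A - {v}) \<union> (J \<union> I)) (W - {v}) =
               reach_prob p ((A - {v}) \<union> J) (W - {v})" by simp
  qed
  also have "\<dots> = subset_mean p (W - A) (\<lambda>J. reach_prob p ((A - {v}) \<union> J) (W - {v}))"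
    using W A by (intro subset_mean_cong subset_mean_const) (auto intro: finite_subset)
  finally show ?thesis .
qed

text \<open>
  Induction on \<open>card W\<close>.  Write \<open>a = card A\<close>, \<open>u = card (W - A)\<close>, \<open>n + 1 = a + u = card W\<close>,
  \<open>z = 1 - (1 - p)^n\<close> and \<open>w = 1 - (1 - p)^(n + 1)\<close>.  The exponents fit because
  \<open>p + (1 - p) z = w\<close>, so the average of \<open>z^card (W - A - J)\<close> over the new neighbours \<open>J\<close> is
  exactly \<open>w^u\<close>; this is the upper bound.  For the lower bound the average carries the extra
  factor \<open>(a - 1 + card J) / n\<close>, and equals \<open>w^(u - 1) ((a - 1) w + u p) / n\<close>.  That this is at
  least \<open>w^u a / (n + 1)\<close> reduces to \<open>w \<le> (n + 1) p\<close>, Bernoulli's inequality.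
\<close>
lemma reach_prob_bounds:
  assumes p: "0 \<le> p" "p \<le> 1" and "finite W" "A \<subseteq> W"
  shows "reach_prob p A W \<le> (1 - (1 - p) ^ card W) ^ card (W - A)" (is "?U A W")
    and "real (card A) / real (card W) * (1 - (1 - p) ^ card W) ^ card (W - A)
           \<le> reach_prob p A W" (is "?L A W")
proof -
  have "?U A W \<and> ?L A W" if "card W = n" for n
    using that assms(3,4)
  proof (induction n arbitrary: W A)
    case 0
    then show ?case by (simp add: reach_prob_def reached_from_def pairs_def subset_mean_const)
  next
    case (Suc n)
    show ?case
    proof (cases "A = {}")
      case True
      have "W \<noteq> {}" using Suc.prems by auto
      then have "reach_prob p A W = 0"
        using True by (simp add: reach_prob_def reached_from_def subset_mean_def)
      moreover have "0 \<le> (1 - (1 - p) ^ card W) ^ card (W - A)"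
        using p by (simp add: power_le_one)
      ultimately show ?thesis using True by simp
    next
      case False
      then obtain v where v: "v \<in> A" by auto
      let ?B = "\<lambda>J. (A - {v}) \<union> J" and ?V = "W - {v}" and ?X = "W - A"
      let ?z = "1 - (1 - p) ^ n" and ?w = "1 - (1 - p) ^ Suc n"
      let ?u = "card ?X"
      have fin: "finite A" "finite ?X" using Suc.prems by (auto intro: finite_subset)
      have cV: "card ?V = n" and BV: "\<And>J. J \<subseteq> ?X \<Longrightarrow> ?B J \<subseteq> ?V"
        using Suc.prems v by auto
      have diff: "?V - ?B J = ?X - J" for J using v by auto
      have cA: "card A \<ge> 1" using v fin by (auto simp: Suc_le_eq card_gt_0_iff)
      have cB: "card (?B J) = card A - 1 + card J" if "J \<subseteq> ?X" for J
      proof -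
        have "card (?B J) = card (A - {v}) + card J"
          using that fin by (intro card_Un_disjoint) (auto intro: finite_subset)
        then show ?thesis using v fin by simp
      qed
      have n: "n = card A - 1 + ?u"
        using Suc.prems card_Diff_subset[of A W] fin card_mono[of W A] cA by auto
      have w: "p + (1 - p) * ?z = ?w" by (simp add: algebra_simps)
      note IH = Suc.IH[OF cV _ BV]
      have rec: "reach_prob p A W = subset_mean p ?X (\<lambda>J. reach_prob p (?B J) ?V)"
        using reach_prob_recursion[OF _ v] Suc.prems by simp
      have "reach_prob p A W \<le> subset_mean p ?X (\<lambda>J. ?z ^ card (?X - J))"
        unfolding rec using IH Suc.prems cV diff by (intro subset_mean_mono p) simp
      also have "\<dots> = ?w ^ ?u" using fin by (simp only: subset_mean_power w)
      finally have upper: "?U A W" using Suc.prems by simp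
      have "real (card A) / real (Suc n) * ?w ^ ?u \<le> reach_prob p A W"
      proof (cases "?u = 0")
        \<comment> \<open>This case is separate because \<open>n\<close> can be 0 here, and the other one divides by \<open>n\<close>.\<close>
        case True
        then have AW: "A = W" using fin Suc.prems by auto
        then have "reach_prob p A W = subset_mean p (pairs W) (\<lambda>_. 1)"
          by (auto simp: reach_prob_def reached_from_def intro!: subset_mean_cong)
        then have "reach_prob p A W = 1"
          using Suc.prems by (simp add: subset_mean_const finite_pairs)
        then show ?thesis using AW Suc.prems by simp
      next
        case False
        then have n0: "n > 0" using n by simp
        let ?a = "real (card A)" and ?r = "real ?u"
        have nr: "real n = ?a - 1 + ?r" using n cA by simp
        have bern: "?w \<le> real (Suc n) * p"
          using Bernoulli_inequality[of "- p" "Suc n"] p by simp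
        have "?a * ?w * real n \<le> ((?a - 1) * ?w + ?r * p) * real (Suc n)"
        proof -
          have "((?a - 1) * y + ?r * p) * real (Suc n) - ?a * y * real n = ?r * (real (Suc n) * p - y)"
            for y using nr by (simp add: nr algebra_simps)
          from this[of ?w] show ?thesis
            using bern by (metis diff_ge_0_iff_ge mult_nonneg_nonneg of_nat_0_le_iff)
        qed
        then have key: "?a / real (Suc n) * ?w \<le> ((?a - 1) * ?w + ?r * p) / real n"
          using n0 by (simp add: field_simps del: of_nat_Suc power_Suc)
        have w0: "0 \<le> ?w" using p by (simp add: power_le_one del: power_Suc)
        have pw: "?w * ?w ^ (?u - 1) = ?w ^ ?u"
          using False by (metis power_eq_if)
        have "?a / real (Suc n) * ?w ^ ?u = ?a / real (Suc n) * ?w * ?w ^ (?u - 1)"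
          unfolding pw[symmetric] by simp
        also have "\<dots> \<le> ((?a - 1) * ?w + ?r * p) / real n * ?w ^ (?u - 1)"
          using key w0 by (intro mult_right_mono zero_le_power)
        also have "\<dots> = (?a - 1) / real n * ?w ^ ?u + 1 / real n * (?r * p * ?w ^ (?u - 1))"
          unfolding pw[symmetric] by (simp add: add_divide_distrib distrib_right)
        also have "\<dots> = subset_mean p ?X (\<lambda>J. (?a - 1) / real n * ?z ^ card (?X - J)
                     + 1 / real n * (real (card J) * ?z ^ card (?X - J)))"
          unfolding subset_mean_add subset_mean_cmult
          using fin by (simp only: subset_mean_power subset_mean_card_power w)
        also have "\<dots> \<le> reach_prob p A W"
          unfolding rec
        proof (intro subset_mean_mono p)
          fix J assume J: "J \<subseteq> ?X"
          have "real (card (?B J)) = ?a - 1 + real (card J)" using cB[OF J] cA by simp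
          then have "(?a - 1) / real n * ?z ^ card (?X - J)
                     + 1 / real n * (real (card J) * ?z ^ card (?X - J))
                     = real (card (?B J)) / real n * ?z ^ card (?X - J)"
            by (simp add: add_divide_distrib distrib_right diff_divide_distrib)
          also have "\<dots> \<le> reach_prob p (?B J) ?V"
            using IH[OF _ J] Suc.prems cV diff by simp
          finally show "(?a - 1) / real n * ?z ^ card (?X - J)
                     + 1 / real n * (real (card J) * ?z ^ card (?X - J)) \<le> reach_prob p (?B J) ?V" .
        qed
        finally show ?thesis .
      qed
      then show ?thesis using upper Suc.prems by simp
    qed
  qed
  then show "?U A W" "?L A W" by blast+
qed

section \<open>The weight of the connected graphs\<close>

lemma configs_bij: "bij_betw (open_edges n) (configs n) (Pow (edges n))"
proof (rule bij_betwI)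
  show "open_edges n \<in> configs n \<rightarrow> Pow (edges n)" by (auto simp: open_edges_def)
  show "(\<lambda>F. \<lambda>e\<in>edges n. of_bool (e \<in> F)) \<in> Pow (edges n) \<rightarrow> configs n"
    by (auto simp: configs_def)
  show "(\<lambda>e\<in>edges n. of_bool (e \<in> open_edges n \<omega>)) = \<omega>" if "\<omega> \<in> configs n" for \<omega>
    using that unfolding configs_def open_edges_def
    by (intro ext) (force simp: PiE_def extensional_def restrict_def)
  show "open_edges n (\<lambda>e\<in>edges n. of_bool (e \<in> F)) = F" if "F \<in> Pow (edges n)" for F
    using that by (auto simp: open_edges_def)
qed

lemma connected_graph_iff_reached:
  assumes "r \<in> V"
  shows "connected_graph V F \<longleftrightarrow> reached_from {r} V F"
proof
  assume "connected_graph V F"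
  then show "reached_from {r} V F"
    using assms by (auto simp: connected_graph_def reached_from_def joined_def adj_def)
next
  assume R: "reached_from {r} V F"
  then have "(r, w) \<in> joined V F" if "w \<in> V" for w
    using assms that by (auto simp: reached_from_def joined_def adj_def)
  then show "connected_graph V F"
    using assms equiv_joined[of V F] unfolding connected_graph_def equiv_def
    by (meson empty_iff symD transD)
qed

lemma components_connected:
  assumes "connected_graph V F"
  shows "card (components V F) = 1"
proof -
  have "joined V F = V \<times> V" using assms by (auto simp: connected_graph_def joined_def)
  then have "components V F = {V}"
    using assms by (auto simp: components_def connected_graph_def quotient_def)
  then show ?thesis by simp
qed

lemma rc_weight_connected:
  assumes "n \<ge> 1"
  shows "rc_weight n l q (connected_event n) = q * reach_prob (l / real n) {1} (vertices n)"
proof -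
  let ?p = "l / real n" and ?V = "vertices n"
  let ?c = "\<lambda>F. reached_from {1} ?V F"
  have V: "1 \<in> ?V" "finite ?V" using assms by (auto simp: vertices_def)
  have E: "edges n = pairs ?V" by (simp add: edges_def pairs_def)
  have fE: "finite (edges n)" using E V finite_pairs by metis
  have fC: "finite (configs n)"
    using fE by (auto simp: configs_def intro!: finite_PiE)
  have prob: "(\<Prod>e\<in>edges n. ?p ^ \<omega> e * (1 - ?p) ^ (1 - \<omega> e))
      = ?p ^ card (open_edges n \<omega>) * (1 - ?p) ^ card (edges n - open_edges n \<omega>)"
    if "\<omega> \<in> configs n" for \<omega>
  proof -
    have "(\<Prod>e\<in>edges n. ?p ^ \<omega> e * (1 - ?p) ^ (1 - \<omega> e))
        = (\<Prod>e\<in>edges n. if e \<in> open_edges n \<omega> then ?p else 1 - ?p)"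
      using that by (intro prod.cong) (auto simp: configs_def open_edges_def PiE_iff)
    also have "\<dots> = (\<Prod>e\<in>edges n \<inter> open_edges n \<omega>. ?p) * (\<Prod>e\<in>edges n - open_edges n \<omega>. 1 - ?p)"
      using fE by (simp add: prod.If_cases Diff_eq)
    also have "edges n \<inter> open_edges n \<omega> = open_edges n \<omega>" by (auto simp: open_edges_def)
    finally show ?thesis by simp
  qed
  have "rc_weight n l q (connected_event n)
      = (\<Sum>\<omega>\<in>{\<omega> \<in> configs n. ?c (open_edges n \<omega>)}.
          ?p ^ card (open_edges n \<omega>) * (1 - ?p) ^ card (edges n - open_edges n \<omega>) * q)"
    unfolding rc_weight_def Let_def connected_event_def num_components_def
      connected_graph_iff_reached[OF V(1)]
    by (intro sum.cong refl)
       (simp add: prob components_connected connected_graph_iff_reached[OF V(1)] del: One_nat_def)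
  also have "\<dots> = (\<Sum>\<omega>\<in>configs n. q * (?p ^ card (open_edges n \<omega>)
       * (1 - ?p) ^ card (edges n - open_edges n \<omega>) * of_bool (?c (open_edges n \<omega>))))"
    using fC by (intro sum.mono_neutral_cong_left) auto
  also have "\<dots> = (\<Sum>F\<in>Pow (edges n). q * (?p ^ card F
       * (1 - ?p) ^ card (edges n - F) * of_bool (?c F)))"
    by (rule sum.reindex_bij_betw[OF configs_bij])
  also have "\<dots> = q * reach_prob ?p {1} ?V"
    by (simp add: reach_prob_def subset_mean_def E sum_distrib_left)
  finally show ?thesis .
qed

text \<open>Connectedness is reachability from the single vertex 1, so \<open>card A = 1\<close> and \<open>card W = n\<close>.\<close>
lemma rc_weight_connected_bounds:
  assumes "q > 0" "n \<ge> 1" "0 \<le> l" "l \<le> real n"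
  defines "w \<equiv> 1 - (1 - l / real n) ^ n"
  shows "rc_weight n l q (connected_event n) \<le> q * w ^ (n - 1)"
    and "q * (1 / real n * w ^ (n - 1)) \<le> rc_weight n l q (connected_event n)"
proof -
  have V: "finite (vertices n)" "{1} \<subseteq> vertices n" "card (vertices n) = n"
    "card (vertices n - {1}) = n - 1"
    using assms by (auto simp: vertices_def)
  have p: "0 \<le> l / real n" "l / real n \<le> 1" using assms by auto
  note b = reach_prob_bounds[OF p V(1,2)]
  show "rc_weight n l q (connected_event n) \<le> q * w ^ (n - 1)"
    using b(1) assms(1) V(3,4) unfolding rc_weight_connected[OF assms(2)] w_def by simp
  have "1 / real n * w ^ (n - 1) \<le> reach_prob (l / real n) {1} (vertices n)"
    using b(2) V(3,4) unfolding w_def by simp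
  then show "q * (1 / real n * w ^ (n - 1)) \<le> rc_weight n l q (connected_event n)"
    using assms(1) unfolding rc_weight_connected[OF assms(2)] by (intro mult_left_mono) auto
qed

section \<open>Passing to the limit\<close>

lemma pi1_pos: "0 < l \<Longrightarrow> 0 < pi1 l"
  by (simp add: pi1_def)

lemma pi1_mono: "l \<le> m \<Longrightarrow> pi1 l \<le> pi1 m"
  by (simp add: pi1_def)

text \<open>
  With \<open>t = l / n\<close>, the powers \<open>exp (- l) = exp (- t)^n\<close> and \<open>(1 - t)^n\<close> have bases in \<open>[0, 1]\<close>
  that differ by at most \<open>t^2\<close>, so they differ by at most \<open>n t^2\<close>.
\<close>
lemma one_minus_power_bounds:
  assumes "n \<ge> 1" "0 \<le> l" "l \<le> real n"
  shows "pi1 l \<le> 1 - (1 - l / real n) ^ n"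
    and "1 - (1 - l / real n) ^ n \<le> pi1 l + l\<^sup>2 / real n"
    and "1 - (1 - l / real n) ^ n \<le> 1"
proof -
  define t where "t = l / real n"
  have t: "0 \<le> t" "t \<le> 1" "real n * t = l" using assms by (auto simp: t_def)
  have e: "exp (- l) = exp (- t) ^ n"
    by (simp add: exp_of_nat_mult[symmetric] t(3)[symmetric])
  have le: "1 - t \<le> exp (- t)" using exp_ge_add_one_self[of "- t"] by simp
  then have "(1 - t) ^ n \<le> exp (- l)" unfolding e using t by (intro power_mono) auto
  then show "pi1 l \<le> 1 - (1 - l / real n) ^ n" by (simp add: pi1_def t_def)
  have "exp (- t) \<le> 1 / (1 + t)"
    using exp_ge_add_one_self[of t] t by (simp add: exp_minus field_simps)
  also have "\<dots> \<le> 1 - t + t\<^sup>2"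
    using t by (simp add: field_simps power2_eq_square)
  finally have gap: "exp (- t) - (1 - t) \<le> t\<^sup>2" by simp
  have "exp (- l) - (1 - t) ^ n \<le> real n * (exp (- t) - (1 - t))"
    using norm_power_diff[of "exp (- t)" "1 - t" n] t le unfolding e by (simp add: abs_le_iff)
  also have "\<dots> \<le> real n * t\<^sup>2" using gap by (intro mult_left_mono) auto
  also have "\<dots> = l\<^sup>2 / real n" using assms by (simp add: t_def power2_eq_square)
  finally show "1 - (1 - l / real n) ^ n \<le> pi1 l + l\<^sup>2 / real n" by (simp add: pi1_def t_def)
  show "1 - (1 - l / real n) ^ n \<le> 1" using t by (simp add: t_def[symmetric])
qed

lemma rc_weight_connected_pos:
  assumes "q > 0" "n \<ge> 1" "0 < l" "l \<le> real n"
  shows "rc_weight n l q (connected_event n) > 0"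
proof -
  have "0 < 1 - (1 - l / real n) ^ n"
    using one_minus_power_bounds(1)[of n l] pi1_pos[of l] assms by linarith
  then have "0 < q * (1 / real n * (1 - (1 - l / real n) ^ n) ^ (n - 1))"
    using assms by simp
  then show ?thesis using rc_weight_connected_bounds(2)[of q n l] assms by linarith
qed

lemma ln_rc_weight_connected_bounds:
  assumes "q > 0" "n \<ge> 1" "0 < l" "l \<le> real n"
  defines "w \<equiv> 1 - (1 - l / real n) ^ n"
  shows "ln (rc_weight n l q (connected_event n)) \<le> ln q + (real n - 1) * ln w"
    and "ln q - ln (real n) + (real n - 1) * ln w \<le> ln (rc_weight n l q (connected_event n))"
proof -
  have w: "0 < w"
    unfolding w_def using one_minus_power_bounds(1)[of n l] pi1_pos[of l] assms by linarith
  have Z: "rc_weight n l q (connected_event n) > 0"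
    using assms by (intro rc_weight_connected_pos)
  have "ln (rc_weight n l q (connected_event n)) \<le> ln (q * w ^ (n - 1))"
    using rc_weight_connected_bounds(1)[of q n l] assms Z w by (intro ln_mono) auto
  also have "\<dots> = ln q + (real n - 1) * ln w"
    using assms w by (simp add: ln_mult ln_realpow of_nat_diff)
  finally show "ln (rc_weight n l q (connected_event n)) \<le> ln q + (real n - 1) * ln w" .
  have "ln q - ln (real n) + (real n - 1) * ln w = ln (q * (1 / real n * w ^ (n - 1)))"
    using assms w by (simp add: ln_mult ln_div ln_realpow of_nat_diff)
  also have "\<dots> \<le> ln (rc_weight n l q (connected_event n))"
    using rc_weight_connected_bounds(2)[of q n l] assms w Z by (intro ln_mono) auto
  finally show "ln q - ln (real n) + (real n - 1) * ln w \<le> ln (rc_weight n l q (connected_event n))" .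
qed

text \<open>
  The four terms of the error are the factor \<open>q\<close>, the factor \<open>1 / n\<close> of the lower bound, the
  exponent \<open>n - 1\<close> in place of \<open>n\<close>, and the distance from \<open>w\<close> to \<open>pi1 l\<close>.  The last two are
  controlled because \<open>pi1\<close> is at least \<open>pi1 m > 0\<close> on the interval.
\<close>
lemma ln_rc_weight_connected_error:
  assumes "q > 0" "n \<ge> 1" "0 < m" "m \<le> l" "l \<le> M" "M \<le> real n"
  shows "\<bar>1 / real n * ln (rc_weight n l q (connected_event n)) - ln (pi1 l)\<bar>
           \<le> (\<bar>ln q\<bar> + ln (real n) - ln (pi1 m) + M\<^sup>2 / pi1 m) / real n"
proof -
  define w where "w = 1 - (1 - l / real n) ^ n"
  define Z where "Z = ln (rc_weight n l q (connected_event n))"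
  have pm: "0 < pi1 m" "pi1 m \<le> pi1 l" using assms by (auto intro: pi1_pos pi1_mono)
  have w: "pi1 l \<le> w" "w \<le> pi1 l + l\<^sup>2 / real n" "w \<le> 1"
    unfolding w_def using one_minus_power_bounds[of n l] assms by auto
  have Z: "Z \<le> ln q + (real n - 1) * ln w" "ln q - ln (real n) + (real n - 1) * ln w \<le> Z"
    unfolding Z_def w_def using ln_rc_weight_connected_bounds[of q n l] assms by auto
  have "ln w - ln (pi1 l) \<le> (w - pi1 l) / pi1 l"
    using ln_diff_le[of w "pi1 l"] pm w by linarith
  also have "\<dots> \<le> (M\<^sup>2 / real n) / pi1 m"
  proof (intro frac_le)
    have "l\<^sup>2 / real n \<le> M\<^sup>2 / real n"
      using assms by (intro divide_right_mono power_mono) auto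
    then show "w - pi1 l \<le> M\<^sup>2 / real n" using w by linarith
  qed (use pm in auto)
  finally have "real n * (ln w - ln (pi1 l)) \<le> real n * (M\<^sup>2 / real n / pi1 m)"
    by (rule mult_left_mono) simp
  then have d: "real n * (ln w - ln (pi1 l)) \<le> M\<^sup>2 / pi1 m"
    using assms(2) by simp
  have lw: "ln (pi1 m) \<le> ln (pi1 l)" "ln (pi1 l) \<le> ln w" "ln w \<le> 0"
    using pm w by (auto intro: ln_mono)
  have ln_n: "0 \<le> ln (real n)" using assms(2) by simp
  have d0: "0 \<le> real n * (ln w - ln (pi1 l))" using lw by simp
  have "Z - real n * ln (pi1 l) \<le> ln q + real n * (ln w - ln (pi1 l)) - ln w"
    using Z(1) by (simp add: algebra_simps)
  moreover have "ln q - ln (real n) + real n * (ln w - ln (pi1 l)) - ln w \<le> Z - real n * ln (pi1 l)"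
    using Z(2) by (simp add: algebra_simps)
  ultimately have "\<bar>Z - real n * ln (pi1 l)\<bar>
      \<le> \<bar>ln q\<bar> + ln (real n) - ln (pi1 m) + M\<^sup>2 / pi1 m"
    using d d0 lw ln_n by linarith
  then have "\<bar>Z - real n * ln (pi1 l)\<bar> / real n
      \<le> (\<bar>ln q\<bar> + ln (real n) - ln (pi1 m) + M\<^sup>2 / pi1 m) / real n"
    by (rule divide_right_mono) simp
  moreover have "1 / real n * Z - ln (pi1 l) = (Z - real n * ln (pi1 l)) / real n"
    using assms(2) by (simp add: field_simps)
  ultimately show ?thesis unfolding Z_def by simp
qed

lemma uniform_limit_interval:
  assumes "q > 0" "0 < m"
  shows "uniform_limit {m..M} (\<lambda>n l. 1 / real n * ln (rc_weight n l q (connected_event n)))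
           (\<lambda>l. ln (pi1 l)) sequentially"
proof (rule uniform_limitI)
  fix e :: real assume "e > 0"
  define c where "c = \<bar>ln q\<bar> - ln (pi1 m) + M\<^sup>2 / pi1 m"
  have "(\<lambda>n. ln (real n) / real n + c / real n) \<longlonglongrightarrow> 0 + 0"
    by (intro tendsto_add lim_ln_over_n lim_const_over_n)
  then have "\<forall>\<^sub>F n in sequentially. ln (real n) / real n + c / real n < e"
    using \<open>e > 0\<close> by (intro order_tendstoD(2)[of _ 0]) auto
  moreover have "\<forall>\<^sub>F n in sequentially. M \<le> real n"
    using filterlim_real_sequentially unfolding filterlim_at_top by blast
  ultimately show "\<forall>\<^sub>F n in sequentially. \<forall>l\<in>{m..M}.
      dist (1 / real n * ln (rc_weight n l q (connected_event n))) (ln (pi1 l)) < e"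
    using eventually_ge_at_top[of 1]
  proof eventually_elim
    case (elim n)
    show ?case
    proof
      fix l assume "l \<in> {m..M}"
      then have "\<bar>1 / real n * ln (rc_weight n l q (connected_event n)) - ln (pi1 l)\<bar>
           \<le> (\<bar>ln q\<bar> + ln (real n) - ln (pi1 m) + M\<^sup>2 / pi1 m) / real n"
        using assms elim by (intro ln_rc_weight_connected_error) auto
      also have "\<dots> = ln (real n) / real n + c / real n"
        by (simp add: c_def add_divide_distrib diff_divide_distrib)
      finally show "dist (1 / real n * ln (rc_weight n l q (connected_event n))) (ln (pi1 l)) < e"
        using elim unfolding dist_real_def by linarith
    qed
  qed
qed

text \<open>
  The diagonal over the compact set \<open>K\<close> is compact, so an open set that contains it contains a
  uniform neighbourhood of it.  This turns ordinary uniform convergence into convergence in the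
  sense of neighbourhoods of the diagonal wherever the limit stays in a compact set of reals.
\<close>
lemma uniform_limit_eventually_near_diagonal:
  fixes f :: "'b \<Rightarrow> 'a \<Rightarrow> 'c::heine_borel"
  assumes lim: "uniform_limit S f g F" and K: "compact K" "g ` S \<subseteq> K"
    and U: "open U" "\<And>y. y \<in> K \<Longrightarrow> (y, y) \<in> U"
  shows "\<forall>\<^sub>F n in F. \<forall>x\<in>S. (f n x, g x) \<in> U"
proof (cases "K = {}")
  case True
  then show ?thesis using K(2) by simp
next
  case False
  let ?D = "(\<lambda>y. (y, y)) ` K"
  have "compact ?D" using K(1) by (intro compact_continuous_image continuous_intros)
  moreover have "?D \<subseteq> U" using U(2) by auto
  ultimately obtain e where e: "e > 0" "{z. infdist z ?D \<le> e} \<subseteq> U"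
    using compact_in_open_separated[of ?D U] U(1) False by auto
  show ?thesis
    using uniform_limitD[OF lim e(1)]
  proof eventually_elim
    case (elim n)
    show ?case
    proof
      fix x assume x: "x \<in> S"
      then have "infdist (f n x, g x) ?D \<le> dist (f n x, g x) (g x, g x)"
        using K(2) by (intro infdist_le) auto
      also have "\<dots> \<le> e" using elim x by (simp add: dist_Pair_Pair less_imp_le)
      finally show "(f n x, g x) \<in> U" using e(2) by auto
    qed
  qed
qed

text \<open>
  For small \<open>l\<close> the function and its limit are both close to \<open>-\<infinity>\<close>.  Indeed \<open>w \<le> l + l^2 / n\<close>
  is below a prescribed \<open>\<eta>\<close> for small \<open>l\<close> and large \<open>n\<close>, and then the upper bound gives at most
  \<open>\<bar>ln q\<bar> + (1 / 2) ln \<eta>\<close> for the normalised logarithm as soon as \<open>n \<ge> 2\<close>.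
\<close>
lemma elog_rc_weight_connected_small:
  fixes B :: real
  assumes q: "q > 0"
  obtains \<delta> where "\<delta> > 0"
    and "\<And>l. l \<le> \<delta> \<Longrightarrow> elog (pi1 l) < ereal B"
    and "\<forall>\<^sub>F n in sequentially. \<forall>l. 0 \<le> l \<longrightarrow> l \<le> \<delta> \<longrightarrow>
           ereal (1 / real n) * elog (rc_weight n l q (connected_event n)) < ereal B"
proof -
  \<comment> \<open>The exponential makes \<open>\<bar>ln q\<bar> + (1 / 2) ln \<eta> \<le> B - 1 / 2\<close>; the bound 1 / 2 makes \<open>ln \<eta>\<close>
    negative, so that \<open>ln \<eta>\<close> itself is below \<open>B\<close> as well.\<close>
  define \<eta> where "\<eta> = min (1 / 2) (exp (2 * (B - \<bar>ln q\<bar>) - 1))"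
  have \<eta>: "0 < \<eta>" "\<eta> < 1" by (auto simp: \<eta>_def)
  have "ln \<eta> \<le> ln (exp (2 * (B - \<bar>ln q\<bar>) - 1))"
    using \<eta> by (intro ln_mono) (auto simp: \<eta>_def)
  then have ln\<eta>: "\<bar>ln q\<bar> + 1 / 2 * ln \<eta> < B" "ln \<eta> < 0" using \<eta> by (auto simp: field_simps)
  have pi1_le: "pi1 l \<le> l" for l using exp_ge_add_one_self[of "- l"] by (simp add: pi1_def)
  define \<delta> where "\<delta> = \<eta> / 2"
  have \<delta>: "\<delta> > 0" "\<delta> < 1" using \<eta> by (auto simp: \<delta>_def)
  show thesis
  proof (rule that[OF \<delta>(1)])
    fix l assume l: "l \<le> \<delta>"
    show "elog (pi1 l) < ereal B"
    proof (cases "pi1 l > 0")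
      case True
      have "ln (pi1 l) \<le> ln \<eta>"
        using l pi1_le[of l] True \<eta> by (intro ln_mono) (auto simp: \<delta>_def)
      then have "ln (pi1 l) < B" using ln\<eta> by linarith
      then show ?thesis using True by (simp add: elog_def)
    qed (simp add: elog_def)
  next
    have "(\<lambda>n. 1 / real n) \<longlonglongrightarrow> 0" by (rule lim_const_over_n)
    then have "\<forall>\<^sub>F n in sequentially. 1 / real n < \<delta>" using \<delta>(1) by (rule order_tendstoD)
    then show "\<forall>\<^sub>F n in sequentially. \<forall>l. 0 \<le> l \<longrightarrow> l \<le> \<delta> \<longrightarrow>
           ereal (1 / real n) * elog (rc_weight n l q (connected_event n)) < ereal B"
      using eventually_ge_at_top[of 2]
    proof eventually_elim
      case (elim n)
      show ?case
      proof (intro allI impI)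
        fix l assume l: "0 \<le> l" "l \<le> \<delta>"
        let ?Z = "rc_weight n l q (connected_event n)"
        let ?w = "1 - (1 - l / real n) ^ n"
        show "ereal (1 / real n) * elog ?Z < ereal B"
        proof (cases "?Z > 0")
          case False
          then show ?thesis using elim by (simp add: elog_def)
        next
          case True
          have ln: "l \<le> real n" using l \<delta> elim by linarith
          have "?Z = 0" if "l = 0"
            using rc_weight_connected_bounds[of q n 0] q elim that by (simp add: power_0_left)
          then have l0: "0 < l" using True l by (cases "l = 0") auto
          have w: "0 < ?w" "?w \<le> pi1 l + l\<^sup>2 / real n"
            using one_minus_power_bounds[of n l] pi1_pos[OF l0] elim ln l by auto
          have "l\<^sup>2 \<le> 1" using l \<delta> by (simp add: power_le_one)
          then have "l\<^sup>2 / real n \<le> 1 / real n" by (rule divide_right_mono) simp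
          then have "?w \<le> \<eta>" using w(2) pi1_le[of l] l elim by (simp add: \<delta>_def)
          then have lw: "ln ?w \<le> ln \<eta>" using w \<eta> by (intro ln_mono) auto
          have "ln ?Z \<le> ln q + (real n - 1) * ln ?w"
            using ln_rc_weight_connected_bounds(1)[of q n l] q elim l0 ln by simp
          also have "\<dots> \<le> \<bar>ln q\<bar> + (real n - 1) * ln \<eta>"
            using lw elim by (intro add_mono mult_left_mono) auto
          also have "\<dots> \<le> real n * \<bar>ln q\<bar> + (real n / 2) * ln \<eta>"
          proof (intro add_mono mult_right_mono_neg)
            show "\<bar>ln q\<bar> \<le> real n * \<bar>ln q\<bar>" using elim by (simp add: mult_le_cancel_right1)
          qed (use elim ln\<eta> in auto)
          also have "\<dots> = real n * (\<bar>ln q\<bar> + 1 / 2 * ln \<eta>)" by (simp add: algebra_simps)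
          also have "\<dots> < real n * B" using ln\<eta> elim by (intro mult_strict_left_mono) auto
          finally have "1 / real n * ln ?Z < B" using elim by (simp add: field_simps)
          then show ?thesis using True by (simp add: elog_def)
        qed
      qed
    qed
  qed
qed

text \<open>
  Split \<open>C\<close> at a small \<open>\<delta>\<close>: below \<open>\<delta>\<close> both functions lie in a neighbourhood of \<open>-\<infinity>\<close>, and
  above \<open>\<delta>\<close> the limit function is real and bounded, so that real uniform convergence applies.
\<close>
lemma ereal_uniform_limit_connected:
  assumes q: "q > 0" and C: "compact C" "C \<subseteq> {0..}"
  shows "ereal_uniform_limit C
           (\<lambda>n l. ereal (1 / real n) * elog (rc_weight n l q (connected_event n)))
           (\<lambda>l. elog (pi1 l)) sequentially"
  unfolding ereal_uniform_limit_def
proof (intro allI impI)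
  fix U :: "(ereal \<times> ereal) set"
  assume "open U \<and> (\<forall>y. (y, y) \<in> U)"
  then have U: "open U" "\<And>y. (y, y) \<in> U" by auto
  let ?f = "\<lambda>n l. ereal (1 / real n) * elog (rc_weight n l q (connected_event n))"
  obtain A1 A2 where A: "open A1" "open A2" "(-\<infinity>, -\<infinity>) \<in> A1 \<times> A2" "A1 \<times> A2 \<subseteq> U"
    using open_prod_elim[OF U] by blast
  obtain b1 b2 where b: "{..<ereal b1} \<subseteq> A1" "{..<ereal b2} \<subseteq> A2"
    using A(1-3) open_MInfty by (metis mem_Sigma_iff)
  define B where "B = min b1 b2"
  have BU: "(x, y) \<in> U" if "x < ereal B" "y < ereal B" for x y
  proof -
    have "x < ereal b1" "y < ereal b2"
      using that by (auto simp: B_def intro: less_le_trans)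
    then show ?thesis using A(4) b by blast
  qed
  obtain \<delta> where \<delta>: "\<delta> > 0" "\<And>l. l \<le> \<delta> \<Longrightarrow> elog (pi1 l) < ereal B"
    "\<forall>\<^sub>F n in sequentially. \<forall>l. 0 \<le> l \<longrightarrow> l \<le> \<delta> \<longrightarrow> ?f n l < ereal B"
    by (rule elog_rc_weight_connected_small[OF q, where B = B]) (rule that, assumption+)
  obtain M where "\<forall>l\<in>C. \<bar>l\<bar> \<le> M"
    using compact_imp_bounded[OF C(1)] unfolding bounded_real by blast
  then have M: "\<And>l. l \<in> C \<Longrightarrow> l \<le> M" by force
  define V where "V = (\<lambda>(x, y). (ereal x, ereal y)) -` U"
  have "continuous_on UNIV (\<lambda>z. (ereal (fst z), ereal (snd z)))"
    by (intro continuous_intros)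
  then have V: "open V"
    unfolding V_def case_prod_beta' using U(1) by (intro open_vimage)
  have "continuous_on {\<delta>..M} (\<lambda>l. ln (pi1 l))"
    unfolding pi1_def using \<delta>(1) by (intro continuous_intros) auto
  then have K: "compact ((\<lambda>l. ln (pi1 l)) ` {\<delta>..M})"
    by (intro compact_continuous_image compact_Icc)
  have "\<forall>\<^sub>F n in sequentially. \<forall>l\<in>{\<delta>..M}.
      (1 / real n * ln (rc_weight n l q (connected_event n)), ln (pi1 l)) \<in> V"
    using uniform_limit_interval[OF q \<delta>(1)] K order_refl V
    by (rule uniform_limit_eventually_near_diagonal) (auto simp: V_def U(2))
  moreover have "\<forall>\<^sub>F n in sequentially. M \<le> real n"
    using filterlim_real_sequentially unfolding filterlim_at_top by blast
  ultimately show "\<forall>\<^sub>F n in sequentially. \<forall>l\<in>C. (?f n l, elog (pi1 l)) \<in> U"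
    using \<delta>(3) eventually_ge_at_top[of 1]
  proof eventually_elim
    case (elim n)
    show ?case
    proof
      fix l assume l: "l \<in> C"
      show "(?f n l, elog (pi1 l)) \<in> U"
      proof (cases "l \<le> \<delta>")
        case True
        then show ?thesis using BU \<delta>(2) elim(3) l C(2) by auto
      next
        case False
        then have l0: "0 < l" "l \<in> {\<delta>..M}" "l \<le> real n"
          using \<delta>(1) M[OF l] elim by auto
        have "0 < rc_weight n l q (connected_event n)"
          using rc_weight_connected_pos q elim l0 by simp
        then show ?thesis using elim(1) l0 pi1_pos by (auto simp: V_def elog_def)
      qed
    qed
  qed
qed

theorem theorem2p3:
  fixes q :: real
  assumes "q > 0"
  shows "(\<forall>l>0. (\<lambda>n. 1 / real n * ln (rc_weight n l q (connected_event n)))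
                   \<longlonglongrightarrow> ln (pi1 l)) \<and>
         (\<forall>C. compact C \<and> C \<subseteq> {0<..} \<longrightarrow>
            uniform_limit C (\<lambda>n l. 1 / real n * ln (rc_weight n l q (connected_event n)))
              (\<lambda>l. ln (pi1 l)) sequentially) \<and>
         (\<forall>C. compact C \<and> C \<subseteq> {0..} \<longrightarrow>
            ereal_uniform_limit C
              (\<lambda>n l. ereal (1 / real n) * elog (rc_weight n l q (connected_event n)))
              (\<lambda>l. elog (pi1 l)) sequentially)"
proof (intro conjI allI impI)
  fix l :: real assume "0 < l"
  show "(\<lambda>n. 1 / real n * ln (rc_weight n l q (connected_event n))) \<longlonglongrightarrow> ln (pi1 l)"
    using tendsto_uniform_limitI[OF uniform_limit_interval[OF assms \<open>0 < l\<close>, of l]] by simp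
next
  fix C :: "real set" assume C: "compact C \<and> C \<subseteq> {0<..}"
  show "uniform_limit C (\<lambda>n l. 1 / real n * ln (rc_weight n l q (connected_event n)))
          (\<lambda>l. ln (pi1 l)) sequentially"
  proof (cases "C = {}")
    case False
    then obtain m M where mM: "m \<in> C" "\<And>l. l \<in> C \<Longrightarrow> m \<le> l" "\<And>l. l \<in> C \<Longrightarrow> l \<le> M"
      using C compact_attains_inf[of C] compact_attains_sup[of C] by metis
    then have "0 < m" "C \<subseteq> {m..M}" using C by auto
    then show ?thesis using uniform_limit_interval[OF assms] uniform_limit_on_subset by blast
  qed simp
next
  fix C :: "real set" assume "compact C \<and> C \<subseteq> {0..}"
  then show "ereal_uniform_limit C
          (\<lambda>n l. ereal (1 / real n) * elog (rc_weight n l q (connected_event n)))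
          (\<lambda>l. elog (pi1 l)) sequentially"
    using ereal_uniform_limit_connected[OF assms] by blast
qed

end
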